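(* Let $P=(x_0,y_0)$ be a point in the interior of the triangle $T$ with vertices $A,B,C$. (i) Suppose that $r$ is finite (a real number) and does not equal the slope of any line through $P$ and one of the vertices of $T$. Then there is a unique ellipse inscribed in $T$ which passes through $P$ and has slope $r$ at $P$. (ii) There is also a unique ellipse inscribed in $T$ which passes through $P$ and has a vertical tangent line at $P$. (iii) Suppose that $r$ does equal the slope of some line through $P$ and one of the vertices of $T$. Then there is no ellipse inscribed in $T$ which passes through $P$ and has slope $r$ at $P$.
   Context: $T$ is a triangle in the $xy$-plane. An ellipse (circles included) is inscribed in $T$ if it lies in $T$ and is tangent to each side of $T$. An ellipse through $P$ has slope $r$ at $P$ if its tangent line at $P$ has slope $r$.
   Formalization: Part (ii) is stated under the added assumption that no line through P and a vertex of T is vertical; otherwise (ii) fails (e.g. A=(0,2), B=(-1,0), C=(1,0), P=(0,1)), and it is proved instead that no such ellipse exists. *)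

theory Defs
  imports "HOL-Analysis.Analysis"
begin

text \<open>
  An ellipse is the curve (not the enclosed region) with centre \<open>c\<close>, orthonormal axis directions
  \<open>u\<close>, \<open>v\<close> and semi-axes \<open>a\<close>, \<open>b\<close>; the case \<open>a = b\<close> gives the circles.
\<close>
definition is_ellipse :: "(real \<times> real) set \<Rightarrow> bool" where
  "is_ellipse E \<longleftrightarrow>
     (\<exists>c u v a b. norm u = 1 \<and> norm v = 1 \<and> u \<bullet> v = 0 \<and> a > 0 \<and> b > 0 \<and>
        E = {X. (((X - c) \<bullet> u) / a)\<^sup>2 + (((X - c) \<bullet> v) / b)\<^sup>2 = 1})"

text \<open>
  The tangent vectors of a set \<open>S\<close> at \<open>Q\<close> are the velocities at \<open>Q\<close> of curves that run in \<open>S\<close>.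
  Requiring the curve to stay in \<open>S\<close> for all times is no restriction, since it can be replaced by
  the constant \<open>Q\<close> away from time 0.
\<close>
definition tangent_vector :: "(real \<times> real) set \<Rightarrow> real \<times> real \<Rightarrow> real \<times> real \<Rightarrow> bool" where
  "tangent_vector S Q d \<longleftrightarrow>
     (\<exists>\<gamma>. (\<forall>t::real. \<gamma> t \<in> S) \<and> \<gamma> 0 = Q \<and> (\<gamma> has_vector_derivative d) (at 0))"

definition tangent_line :: "(real \<times> real) set \<Rightarrow> real \<times> real \<Rightarrow> (real \<times> real) set" where
  "tangent_line S Q = {Q + d | d. tangent_vector S Q d}"

definition has_slope :: "(real \<times> real) set \<Rightarrow> real \<Rightarrow> bool" where
  "has_slope L r \<longleftrightarrow> (\<exists>k. L = {(x, y). y = r * x + k})"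

definition is_vertical :: "(real \<times> real) set \<Rightarrow> bool" where
  "is_vertical L \<longleftrightarrow> (\<exists>k. L = {(x, y). x = k})"

definition tangent_to_side :: "(real \<times> real) set \<Rightarrow> real \<times> real \<Rightarrow> real \<times> real \<Rightarrow> bool" where
  "tangent_to_side E A B \<longleftrightarrow>
     (\<exists>Q \<in> E \<inter> closed_segment A B. tangent_line E Q = affine hull {A, B})"

definition inscribed_ellipse ::
    "(real \<times> real) set \<Rightarrow> real \<times> real \<Rightarrow> real \<times> real \<Rightarrow> real \<times> real \<Rightarrow> bool" where
  "inscribed_ellipse E A B C \<longleftrightarrow>
     is_ellipse E \<and> E \<subseteq> convex hull {A, B, C} \<and>
     tangent_to_side E A B \<and> tangent_to_side E B C \<and> tangent_to_side E C A"

end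

theory Submission
  imports Defs
begin

text \<open>
  Write an ellipse as \<open>{c + s e + t f | s\<^sup>2 + t\<^sup>2 = 1}\<close> with conjugate half-diameters \<open>e\<close>, \<open>f\<close>. These may be
  rotated so that \<open>P = c + e\<close>, and then \<open>f = k d\<close> is the tangent direction at \<open>P\<close>. In barycentric
  coordinates, let \<open>x\<^sub>i\<close>, \<open>\<delta>\<^sub>i\<close>, \<open>a\<^sub>i\<close> be the coordinates of \<open>P\<close>, \<open>d\<close>, \<open>e\<close>. The \<open>i\<close>-th coordinate
  on the ellipse has minimum \<open>(x\<^sub>i - a\<^sub>i) - sqrt (a\<^sub>i\<^sup>2 + k\<^sup>2 \<delta>\<^sub>i\<^sup>2)\<close>, so the ellipse is inscribed iff this
  vanishes for each \<open>i\<close>, that is, \<open>a\<^sub>i = (x\<^sub>i - k\<^sup>2 \<delta>\<^sub>i\<^sup>2 / x\<^sub>i) / 2\<close>. As \<open>\<Sum> x\<^sub>i = 1\<close> and \<open>\<Sum> a\<^sub>i = 0\<close>, this forces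
  \<open>k\<^sup>2 \<Sum> \<delta>\<^sub>i\<^sup>2 / x\<^sub>i = 1\<close>: the ellipse is determined by \<open>P\<close> and \<open>d\<close>. Conversely these formulas give
  an ellipse iff \<open>e\<close> and \<open>d\<close> are independent, which holds iff the ratios \<open>\<delta>\<^sub>i / x\<^sub>i\<close> are pairwise
  distinct, i.e. iff no vertex lies on the line through \<open>P\<close> in direction \<open>d\<close>.
\<close>

section \<open>Planar cross products\<close>

definition cross2 :: "real \<times> real \<Rightarrow> real \<times> real \<Rightarrow> real" where
  "cross2 u v = fst u * snd v - snd u * fst v"

lemma cross2_linear:
  "cross2 (u + v) w = cross2 u w + cross2 v w" "cross2 w (u + v) = cross2 w u + cross2 w v"
  "cross2 (u - v) w = cross2 u w - cross2 v w" "cross2 w (u - v) = cross2 w u - cross2 w v"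
  "cross2 (k *\<^sub>R u) v = k * cross2 u v" "cross2 u (k *\<^sub>R v) = k * cross2 u v"
  "cross2 (- u) v = - cross2 u v" "cross2 u (- v) = - cross2 u v"
  "cross2 u u = 0" "cross2 0 u = 0" "cross2 u 0 = 0"
  by (auto simp: cross2_def algebra_simps)

lemma cross2_commute: "cross2 v u = - cross2 u v"
  by (simp add: cross2_def)

text \<open>Cramer's rule with the denominator cleared, so it also holds for dependent
  \<open>e\<close>, \<open>f\<close>.\<close>

lemma cross2_expand: "cross2 e f *\<^sub>R w = cross2 w f *\<^sub>R e + cross2 e w *\<^sub>R f"
  by (cases e; cases f; cases w) (simp add: cross2_def algebra_simps)

lemma cross2_basis:
  assumes "cross2 e f \<noteq> 0"
  shows "w = (cross2 w f / cross2 e f) *\<^sub>R e + (cross2 e w / cross2 e f) *\<^sub>R f"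
proof -
  have "w = inverse (cross2 e f) *\<^sub>R (cross2 e f *\<^sub>R w)"
    using assms by simp
  also have "\<dots> = (cross2 w f / cross2 e f) *\<^sub>R e + (cross2 e w / cross2 e f) *\<^sub>R f"
    by (subst cross2_expand) (simp add: scaleR_add_right divide_inverse mult.commute)
  finally show ?thesis .
qed

text \<open>\<open>d\<close> and its quarter turn form a basis, and the component of
  \<open>w\<close> along the quarter turn is proportional to \<open>cross2 w d\<close>.\<close>

lemma cross2_eq_0_iff:
  assumes "d \<noteq> 0"
  shows "cross2 w d = 0 \<longleftrightarrow> (\<exists>k. w = k *\<^sub>R d)"
proof
  assume w: "cross2 w d = 0"
  have "snd d * snd d + fst d * fst d \<noteq> 0"
    using assms by (auto simp: sum_squares_eq_zero_iff prod_eq_iff)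
  moreover have "cross2 (- snd d, fst d) d = - (snd d * snd d + fst d * fst d)"
    by (simp add: cross2_def)
  ultimately have "cross2 (- snd d, fst d) d \<noteq> 0"
    by linarith
  from cross2_basis[OF this, of w] w show "\<exists>k. w = k *\<^sub>R d"
    by (metis add_0 div_0 scale_zero_left)
qed (auto simp: cross2_linear)

text \<open>Lagrange's identity; it shows that orthonormal pairs have nonzero cross product.\<close>

lemma cross2_sq: "(cross2 u v)\<^sup>2 = (norm u)\<^sup>2 * (norm v)\<^sup>2 - (u \<bullet> v)\<^sup>2"
  by (cases u; cases v) (simp add: cross2_def norm_prod_def power2_eq_square algebra_simps)

section \<open>Ellipses given by conjugate half-diameters, and their tangent lines\<close>

definition ell :: "real \<times> real \<Rightarrow> real \<times> real \<Rightarrow> real \<times> real \<Rightarrow> (real \<times> real) set" where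
  "ell c e f = {c + s *\<^sub>R e + t *\<^sub>R f | s t. s\<^sup>2 + t\<^sup>2 = 1}"

lemma ellI: "s\<^sup>2 + t\<^sup>2 = 1 \<Longrightarrow> c + s *\<^sub>R e + t *\<^sub>R f \<in> ell c e f"
  by (auto simp: ell_def)

lemma ell_orthonormal:
  assumes "norm u = 1" "norm v = 1" "u \<bullet> v = 0" "a > 0" "b > 0"
  shows "ell c (a *\<^sub>R u) (b *\<^sub>R v) = {X. (((X - c) \<bullet> u) / a)\<^sup>2 + (((X - c) \<bullet> v) / b)\<^sup>2 = 1}"
    and "cross2 (a *\<^sub>R u) (b *\<^sub>R v) \<noteq> 0"
proof -
  have "(cross2 u v)\<^sup>2 = 1"
    using assms by (simp add: cross2_sq)
  then show nz: "cross2 (a *\<^sub>R u) (b *\<^sub>R v) \<noteq> 0"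
    using assms by (auto simp: cross2_linear)
  have uv: "u \<bullet> u = 1" "v \<bullet> v = 1" "v \<bullet> u = 0"
    using assms by (auto simp: norm_eq_1 inner_commute)
  have *: "((c + s *\<^sub>R a *\<^sub>R u + t *\<^sub>R b *\<^sub>R v - c) \<bullet> u) / a = s"
          "((c + s *\<^sub>R a *\<^sub>R u + t *\<^sub>R b *\<^sub>R v - c) \<bullet> v) / b = t" for s t
    using assms uv by (simp_all add: inner_add_left inner_diff_left)
  show "ell c (a *\<^sub>R u) (b *\<^sub>R v) = {X. (((X - c) \<bullet> u) / a)\<^sup>2 + (((X - c) \<bullet> v) / b)\<^sup>2 = 1}"
    (is "_ = ?R")
  proof
    show "ell c (a *\<^sub>R u) (b *\<^sub>R v) \<subseteq> ?R"
      unfolding ell_def using * by force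
    show "?R \<subseteq> ell c (a *\<^sub>R u) (b *\<^sub>R v)"
    proof
      fix X assume X: "X \<in> ?R"
      obtain s t where "X - c = s *\<^sub>R a *\<^sub>R u + t *\<^sub>R b *\<^sub>R v"
        using cross2_basis[OF nz] by blast
      then have "X = c + s *\<^sub>R a *\<^sub>R u + t *\<^sub>R b *\<^sub>R v"
        by (simp add: algebra_simps)
      then show "X \<in> ell c (a *\<^sub>R u) (b *\<^sub>R v)"
        using X *[of s t] ellI[of s t c "a *\<^sub>R u" "b *\<^sub>R v"] by simp
    qed
  qed
qed

lemma ell_rotate_subset:
  assumes "s\<^sup>2 + t\<^sup>2 = 1"
  shows "ell c (s *\<^sub>R e + t *\<^sub>R f) (- t *\<^sub>R e + s *\<^sub>R f) \<subseteq> ell c e f"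
proof
  fix X assume "X \<in> ell c (s *\<^sub>R e + t *\<^sub>R f) (- t *\<^sub>R e + s *\<^sub>R f)"
  then obtain x y where xy: "x\<^sup>2 + y\<^sup>2 = 1"
    and X: "X = c + x *\<^sub>R (s *\<^sub>R e + t *\<^sub>R f) + y *\<^sub>R (- t *\<^sub>R e + s *\<^sub>R f)"
    by (auto simp: ell_def)
  have "X = c + (x * s - y * t) *\<^sub>R e + (x * t + y * s) *\<^sub>R f"
    by (simp add: X algebra_simps)
  moreover have "(x * s - y * t)\<^sup>2 + (x * t + y * s)\<^sup>2 = (x\<^sup>2 + y\<^sup>2) * (s\<^sup>2 + t\<^sup>2)"
    by algebra
  ultimately show "X \<in> ell c e f"
    using xy assms ellI by auto
qed

lemma ell_rotate:
  assumes "s\<^sup>2 + t\<^sup>2 = 1"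
  shows "ell c (s *\<^sub>R e + t *\<^sub>R f) (- t *\<^sub>R e + s *\<^sub>R f) = ell c e f"
    and "cross2 (s *\<^sub>R e + t *\<^sub>R f) (- t *\<^sub>R e + s *\<^sub>R f) = cross2 e f"
proof -
  let ?e = "s *\<^sub>R e + t *\<^sub>R f" and ?f = "- t *\<^sub>R e + s *\<^sub>R f"
  \<comment> \<open>The inverse rotation recovers \<open>e\<close> and \<open>f\<close>, so the
    inclusion already proved also yields the reverse one.\<close>
  have "s *\<^sub>R ?e + (- t) *\<^sub>R ?f = (s\<^sup>2 + t\<^sup>2) *\<^sub>R e" "- (- t) *\<^sub>R ?e + s *\<^sub>R ?f = (s\<^sup>2 + t\<^sup>2) *\<^sub>R f"
    by (simp_all add: algebra_simps power2_eq_square)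
  then show "ell c ?e ?f = ell c e f"
    using ell_rotate_subset[of s t c e f] ell_rotate_subset[of s "- t" c ?e ?f] assms by simp
  have "cross2 ?e ?f = (s\<^sup>2 + t\<^sup>2) * cross2 e f"
    using cross2_commute[of e f] by (simp add: cross2_linear algebra_simps power2_eq_square)
  then show "cross2 ?e ?f = cross2 e f" using assms by simp
qed

lemma ell_reflect: "ell c e (- f) = ell c e f"
proof -
  have "ell c e (- f) \<subseteq> ell c e f" for f
  proof
    fix X assume "X \<in> ell c e (- f)"
    then obtain s t where "s\<^sup>2 + t\<^sup>2 = 1" "X = c + s *\<^sub>R e + t *\<^sub>R (- f)"
      by (auto simp: ell_def)
    then show "X \<in> ell c e f"
      using ellI[of s "- t" c e f] by simp
  qed
  from this[of f] this[of "- f"] show ?thesis by auto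
qed

text \<open>Frees the half-diameters from orthogonality, so that they can be adapted to a chosen
  point of the ellipse. The converse is the existence of principal axes.\<close>

lemma is_ellipse_iff: "is_ellipse E \<longleftrightarrow> (\<exists>c e f. cross2 e f \<noteq> 0 \<and> E = ell c e f)"
proof
  assume "is_ellipse E"
  then obtain c u v a b where "norm u = 1" "norm v = 1" "u \<bullet> v = 0" "a > 0" "b > 0"
    and E: "E = {X. (((X - c) \<bullet> u) / a)\<^sup>2 + (((X - c) \<bullet> v) / b)\<^sup>2 = 1}"
    unfolding is_ellipse_def by blast
  from ell_orthonormal[OF this(1-5)] show "\<exists>c e f. cross2 e f \<noteq> 0 \<and> E = ell c e f"
    unfolding E by metis
next
  assume "\<exists>c e f. cross2 e f \<noteq> 0 \<and> E = ell c e f"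
  then obtain c e f where ef: "cross2 e f \<noteq> 0" "E = ell c e f" by blast
  \<comment> \<open>Rotating the half-diameters by a right angle negates their inner product, so some rotation
    makes them orthogonal.\<close>
  define g where "g \<phi> = (cos \<phi> *\<^sub>R e + sin \<phi> *\<^sub>R f) \<bullet> (- sin \<phi> *\<^sub>R e + cos \<phi> *\<^sub>R f)" for \<phi> :: real
  have cont: "continuous_on {0..pi / 2} g"
    unfolding g_def by (intro continuous_intros)
  have g0: "g 0 = e \<bullet> f" "g (pi / 2) = - (e \<bullet> f)"
    by (simp_all add: g_def inner_commute)
  have "\<exists>\<phi>. g \<phi> = 0"
  proof (cases "e \<bullet> f \<le> 0")
    case True
    then show ?thesis using IVT'[of g 0 0 "pi / 2"] cont g0 by auto
  next
    case False
    then show ?thesis using IVT2'[of g "pi / 2" 0 0] cont g0 by auto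
  qed
  then obtain \<phi> where \<phi>: "g \<phi> = 0" by blast
  define e' f' where "e' = cos \<phi> *\<^sub>R e + sin \<phi> *\<^sub>R f" and "f' = - sin \<phi> *\<^sub>R e + cos \<phi> *\<^sub>R f"
  have "(cos \<phi>)\<^sup>2 + (sin \<phi>)\<^sup>2 = 1" by simp
  from ell_rotate[OF this] have E: "E = ell c e' f'" and nz: "cross2 e' f' \<noteq> 0"
    using ef by (auto simp: e'_def f'_def)
  from nz have nz': "e' \<noteq> 0" "f' \<noteq> 0"
    by (auto simp: cross2_linear)
  have orth: "e' \<bullet> f' = 0" using \<phi> by (simp add: g_def e'_def f'_def)
  show "is_ellipse E"
    unfolding is_ellipse_def
  proof (intro exI conjI)
    show "norm (sgn e') = 1" "norm (sgn f') = 1" "norm e' > 0" "norm f' > 0"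
      using nz' by (auto simp: norm_sgn)
    show "sgn e' \<bullet> sgn f' = 0"
      using orth by (simp add: sgn_div_norm)
    then show "E = {X. (((X - c) \<bullet> sgn e') / norm e')\<^sup>2 + (((X - c) \<bullet> sgn f') / norm f')\<^sup>2 = 1}"
      using ell_orthonormal(1)[of "sgn e'" "sgn f'" "norm e'" "norm f'" c] nz'
      by (simp add: E norm_sgn) (simp add: sgn_div_norm)
  qed
qed

lemma ell_through_point:
  assumes "cross2 e f \<noteq> 0" "Q \<in> ell c e f"
  obtains e' f' where "cross2 e' f' \<noteq> 0" "ell c e f = ell c e' f'" "Q = c + e'"
proof -
  obtain s t where "s\<^sup>2 + t\<^sup>2 = 1" "Q = c + (s *\<^sub>R e + t *\<^sub>R f)"
    using assms(2) by (auto simp: ell_def add.assoc)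
  with ell_rotate[OF this(1)] assms(1) show ?thesis
    using that by metis
qed

text \<open>Differentiating the implicit equation along any curve in the ellipse bounds the tangent
  vectors; the trigonometric parametrisation realises all that remain.\<close>

lemma tangent_line_ell:
  assumes "cross2 e f \<noteq> 0"
  shows "tangent_line (ell c e f) (c + e) = {X. cross2 (X - (c + e)) f = 0}"
proof -
  have f: "f \<noteq> 0" using assms by (auto simp: cross2_linear)
  have 1: "cross2 d f = 0" if tv: "tangent_vector (ell c e f) (c + e) d" for d
  proof -
    obtain \<gamma> :: "real \<Rightarrow> real \<times> real" where \<gamma>: "\<And>t. \<gamma> t \<in> ell c e f" "\<gamma> 0 = c + e"
      "(\<gamma> has_vector_derivative d) (at 0)"
      using tv unfolding tangent_vector_def by blast
    \<comment> \<open>By Cramer's rule the ellipse satisfies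
      \<open>G t = (cross2 e f)\<^sup>2\<close>. At time 0 the second square contributes no
      derivative, because \<open>\<gamma> 0 - c = e\<close>.\<close>
    define G where "G t = (cross2 (\<gamma> t - c) f)\<^sup>2 + (cross2 e (\<gamma> t - c))\<^sup>2" for t
    have "G t = (cross2 e f)\<^sup>2" for t
    proof -
      obtain x y where "x\<^sup>2 + y\<^sup>2 = 1" "\<gamma> t = c + x *\<^sub>R e + y *\<^sub>R f"
        using \<gamma>(1)[of t] by (auto simp: ell_def)
      moreover have "(x * cross2 e f)\<^sup>2 + (y * cross2 e f)\<^sup>2 = (x\<^sup>2 + y\<^sup>2) * (cross2 e f)\<^sup>2"
        by algebra
      ultimately show ?thesis
        by (simp add: G_def cross2_linear)
    qed
    then have "G = (\<lambda>_. (cross2 e f)\<^sup>2)" by auto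
    then have G0: "(G has_real_derivative 0) (at 0)" by simp
    have [derivative_intros]: "((\<lambda>t. fst (\<gamma> t)) has_real_derivative fst d) (at 0)"
         "((\<lambda>t. snd (\<gamma> t)) has_real_derivative snd d) (at 0)"
      using bounded_linear.has_vector_derivative[OF bounded_linear_fst \<gamma>(3)]
        bounded_linear.has_vector_derivative[OF bounded_linear_snd \<gamma>(3)]
      by (simp_all add: has_real_derivative_iff_has_vector_derivative)
    have "(G has_real_derivative 2 * cross2 e f * cross2 d f) (at 0)"
      unfolding G_def cross2_def fst_diff snd_diff
      by (rule derivative_eq_intros refl | simp)+
        (simp add: \<gamma>(2) algebra_simps)
    from DERIV_unique[OF this G0] assms show "cross2 d f = 0" by simp
  qed
  have 2: "tangent_vector (ell c e f) (c + e) (k *\<^sub>R f)" for k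
    unfolding tangent_vector_def
  proof (intro exI conjI allI)
    \<comment> \<open>Angular speed \<open>k\<close> gives the velocity \<open>k *\<^sub>R f\<close>
      at time 0.\<close>
    let ?\<gamma> = "\<lambda>t. c + cos (k * t) *\<^sub>R e + sin (k * t) *\<^sub>R f"
    show "?\<gamma> t \<in> ell c e f" for t by (intro ellI) simp
    show "?\<gamma> 0 = c + e" by simp
    show "(?\<gamma> has_vector_derivative k *\<^sub>R f) (at 0)"
      by (rule derivative_eq_intros refl | simp)+
  qed
  have "tangent_vector (ell c e f) (c + e) d \<longleftrightarrow> cross2 d f = 0" for d
    using 1 2 cross2_eq_0_iff[OF f] by metis
  then have "tangent_line (ell c e f) (c + e) = (\<lambda>d. c + e + d) ` {d. cross2 d f = 0}"
    unfolding tangent_line_def by blast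
  also have "\<dots> = {X. cross2 (X - (c + e)) f = 0}"
  proof (intro equalityI subsetI)
    fix X assume "X \<in> {X. cross2 (X - (c + e)) f = 0}"
    then show "X \<in> (\<lambda>d. c + e + d) ` {d. cross2 d f = 0}"
      by (intro image_eqI[of _ _ "X - (c + e)"]) simp_all
  qed auto
  finally show ?thesis .
qed

section \<open>Lines, slopes and direction vectors\<close>

lemma affine_hull_cross2:
  assumes "B \<noteq> C"
  shows "affine hull {B, C} = {X. cross2 (X - B) (B - C) = 0}"
proof -
  have "X \<in> affine hull {B, C} \<longleftrightarrow> (\<exists>k. X - B = k *\<^sub>R (B - C))" for X
  proof
    assume "X \<in> affine hull {B, C}"
    then obtain u v where "u + v = 1" "X = u *\<^sub>R B + v *\<^sub>R C"
      by (auto simp: affine_hull_2)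
    moreover from this have "X = (1 - v) *\<^sub>R B + v *\<^sub>R C"
      by (simp add: eq_diff_eq)
    ultimately have "X - B = (- v) *\<^sub>R (B - C)"
      by (simp add: algebra_simps)
    then show "\<exists>k. X - B = k *\<^sub>R (B - C)" by blast
  next
    assume "\<exists>k. X - B = k *\<^sub>R (B - C)"
    then obtain k where "X - B = k *\<^sub>R (B - C)" by blast
    then have "X = (1 + k) *\<^sub>R B + (- k) *\<^sub>R C"
      by (simp add: algebra_simps)
    moreover have "(1 + k) + (- k) = 1" by simp
    ultimately show "X \<in> affine hull {B, C}"
      unfolding affine_hull_2 by blast
  qed
  then show ?thesis using assms by (auto simp: cross2_eq_0_iff)
qed

lemma line_eq_iff:
  assumes "d \<noteq> 0" "d' \<noteq> 0"
  shows "{X. cross2 (X - P) d = 0} = {X. cross2 (X - P) d' = 0} \<longleftrightarrow> cross2 d d' = 0"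
proof
  assume eq: "{X. cross2 (X - P) d = 0} = {X. cross2 (X - P) d' = 0}"
  have "P + d \<in> {X. cross2 (X - P) d = 0}"
    by (simp add: cross2_linear)
  then show "cross2 d d' = 0"
    unfolding eq by simp
next
  assume "cross2 d d' = 0"
  then obtain k where k: "d = k *\<^sub>R d'"
    using cross2_eq_0_iff assms by blast
  with assms have "k \<noteq> 0" by auto
  with k show "{X. cross2 (X - P) d = 0} = {X. cross2 (X - P) d' = 0}"
    by (simp add: cross2_linear)
qed

text \<open>Turns slope \<open>r\<close> into the direction \<open>(1, r)\<close>. With the
  direction \<open>(0, 1)\<close> for vertical lines, both cases reduce to one statement about
  directions.\<close>

lemma has_slope_iff:
  assumes "P \<in> L"
  shows "has_slope L r \<longleftrightarrow> L = {X. cross2 (X - P) (1, r) = 0}"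
proof
  assume "has_slope L r"
  then obtain k where k: "L = {(x, y). y = r * x + k}"
    by (auto simp: has_slope_def)
  with assms show "L = {X. cross2 (X - P) (1, r) = 0}"
    by (auto simp: cross2_def algebra_simps)
next
  assume "L = {X. cross2 (X - P) (1, r) = 0}"
  then have "L = {(x, y). y = r * x + (snd P - r * fst P)}"
    by (auto simp: cross2_def algebra_simps)
  then show "has_slope L r"
    unfolding has_slope_def by blast
qed

lemma is_vertical_iff:
  assumes "P \<in> L"
  shows "is_vertical L \<longleftrightarrow> L = {X. cross2 (X - P) (0, 1) = 0}"
proof
  assume "is_vertical L"
  then obtain k where k: "L = {(x, y). x = k}"
    by (auto simp: is_vertical_def)
  with assms show "L = {X. cross2 (X - P) (0, 1) = 0}"
    by (auto simp: cross2_def)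
next
  assume "L = {X. cross2 (X - P) (0, 1) = 0}"
  then have "L = {(x, y). x = fst P}"
    by (auto simp: cross2_def)
  then show "is_vertical L"
    unfolding is_vertical_def by blast
qed

text \<open>The constant curve has velocity 0. This supplies the base point for expressing slope and
  verticality of a tangent line by directions.\<close>

lemma point_in_tangent_line: "Q \<in> S \<Longrightarrow> Q \<in> tangent_line S Q"
proof -
  assume "Q \<in> S"
  then have "tangent_vector S Q 0"
    unfolding tangent_vector_def by (intro exI[of _ "\<lambda>_. Q"]) (auto intro: has_vector_derivative_const)
  then show "Q \<in> tangent_line S Q"
    unfolding tangent_line_def by force
qed

section \<open>Barycentric coordinates\<close>

lemma cross2_cyclic: "cross2 (B - C) (C - A) = cross2 (A - B) (B - C)"
  by (simp add: cross2_def algebra_simps)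

lemma cross2_eq_0_imp_collinear:
  assumes "cross2 (A - B) (B - C) = 0"
  shows "collinear {A, B, C}"
proof (cases "B = C")
  case False
  then have "A \<in> affine hull {B, C}"
    using assms by (simp add: affine_hull_cross2)
  then show ?thesis
    using collinear_affine_hull_collinear[of "{A, B, C}"]
    by (metis collinear_3_affine_hull False insert_commute)
qed simp

text \<open>
  The barycentric coordinate belonging to the vertex \<open>A\<close> and, below, its linear part; the other
  coordinates are obtained by permuting the vertices cyclically.
\<close>
definition bary :: "real \<times> real \<Rightarrow> real \<times> real \<Rightarrow> real \<times> real \<Rightarrow> real \<times> real \<Rightarrow> real" where
  "bary A B C X = cross2 (X - B) (B - C) / cross2 (A - B) (B - C)"

definition blin :: "real \<times> real \<Rightarrow> real \<times> real \<Rightarrow> real \<times> real \<Rightarrow> real \<times> real \<Rightarrow> real" where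
  "blin A B C d = cross2 d (B - C) / cross2 (A - B) (B - C)"

lemma bary_add: "bary A B C (X + d) = bary A B C X + blin A B C d"
  by (simp add: bary_def blin_def cross2_linear add_divide_distrib[symmetric])

lemma bary_diff: "bary A B C (X - d) = bary A B C X - blin A B C d"
  by (simp add: bary_def blin_def cross2_linear diff_divide_distrib[symmetric])

lemma blin_linear:
  "blin A B C (u + v) = blin A B C u + blin A B C v"
  "blin A B C (k *\<^sub>R u) = k * blin A B C u"
  by (simp_all only: blin_def cross2_linear(1,3,5) add_divide_distrib times_divide_eq_right)

text \<open>\<open>cross2 (A - B) (B - C)\<close> is twice the signed area of the triangle; the
  signed areas of the three triangles spanned by \<open>X\<close> and a side add up to the
  whole.\<close>

lemma bary_sum:
  assumes "cross2 (A - B) (B - C) \<noteq> 0"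
  shows "bary A B C X + bary B C A X + bary C A B X = 1"
proof -
  have "cross2 (X - B) (B - C) + cross2 (X - C) (C - A) + cross2 (X - A) (A - B) = cross2 (A - B) (B - C)"
    by (simp add: cross2_def algebra_simps)
  then show ?thesis
    using assms unfolding bary_def cross2_cyclic cross2_cyclic[of C A B, symmetric]
    by (simp add: add_divide_distrib[symmetric])
qed

lemma blin_sum:
  assumes "cross2 (A - B) (B - C) \<noteq> 0"
  shows "blin A B C d + blin B C A d + blin C A B d = 0"
  \<comment> \<open>Writing \<open>d\<close> as \<open>0 + d\<close> lets \<open>bary_add\<close>
    split off the linear part; the two sums of 1 are then subtracted.\<close>
  using bary_sum[OF assms, of 0] bary_sum[OF assms, of "0 + d"]
  by (simp only: bary_add)

lemma bary_expand:
  assumes "cross2 (A - B) (B - C) \<noteq> 0"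
  shows "X = bary A B C X *\<^sub>R A + bary B C A X *\<^sub>R B + bary C A B X *\<^sub>R C"
proof -
  have "X - B = bary A B C X *\<^sub>R (A - B) + (cross2 (A - B) (X - B) / cross2 (A - B) (B - C)) *\<^sub>R (B - C)"
    unfolding bary_def by (rule cross2_basis[OF assms])
  moreover have "cross2 (A - B) (X - B) / cross2 (A - B) (B - C) = - bary C A B X"
  proof -
    have "cross2 (A - B) (X - B) = - cross2 (X - A) (A - B)"
      by (simp add: cross2_def algebra_simps)
    then show ?thesis
      by (simp add: bary_def cross2_cyclic[of C A B, symmetric] cross2_cyclic)
  qed
  ultimately have X: "X = B + bary A B C X *\<^sub>R (A - B) - bary C A B X *\<^sub>R (B - C)"
    by (simp add: algebra_simps)
  have "bary B C A X = 1 - bary A B C X - bary C A B X"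
    using bary_sum[OF assms, of X] by simp
  then have "bary A B C X *\<^sub>R A + bary B C A X *\<^sub>R B + bary C A B X *\<^sub>R C
    = B + bary A B C X *\<^sub>R (A - B) - bary C A B X *\<^sub>R (B - C)"
    by (simp only:) (simp add: algebra_simps)
  with X show ?thesis by simp
qed

lemma bary_comb:
  assumes "cross2 (A - B) (B - C) \<noteq> 0" "u + v + w = 1"
  shows "bary A B C (u *\<^sub>R A + v *\<^sub>R B + w *\<^sub>R C) = u"
proof -
  have v: "v = 1 - u - w" using assms by simp
  have "u *\<^sub>R A + v *\<^sub>R B + w *\<^sub>R C - B = u *\<^sub>R (A - B) - w *\<^sub>R (B - C)"
    unfolding v by (simp add: algebra_simps)
  then show ?thesis
    using assms by (simp add: bary_def cross2_linear(3,5,9))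
qed

lemma blin_comb:
  assumes "cross2 (A - B) (B - C) \<noteq> 0" "u + v + w = 0"
  shows "blin A B C (u *\<^sub>R A + v *\<^sub>R B + w *\<^sub>R C) = u"
proof -
  have v: "v = - u - w" using assms by simp
  have "u *\<^sub>R A + v *\<^sub>R B + w *\<^sub>R C = u *\<^sub>R (A - B) - w *\<^sub>R (B - C)"
    unfolding v by (simp add: algebra_simps)
  then show ?thesis
    using assms by (simp add: blin_def cross2_linear(3,5,9))
qed

text \<open>Two linear coordinates suffice, since the three sum to 0.\<close>

lemma blin_eqI:
  assumes "cross2 (A - B) (B - C) \<noteq> 0" "blin A B C u = blin A B C v" "blin B C A u = blin B C A v"
  shows "u = v"
proof -
  have "blin C A B u = blin C A B v"
    using blin_sum[OF assms(1), of u] blin_sum[OF assms(1), of v] assms(2,3) by simp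
  then have "0 + u = 0 + v"
    using bary_expand[OF assms(1), of "0 + u"] bary_expand[OF assms(1), of "0 + v"] assms(2,3)
    by (simp only: bary_add)
  then show ?thesis by simp
qed

lemma convex_hull_bary:
  assumes "cross2 (A - B) (B - C) \<noteq> 0"
  shows "X \<in> convex hull {A, B, C} \<longleftrightarrow> bary A B C X \<ge> 0 \<and> bary B C A X \<ge> 0 \<and> bary C A B X \<ge> 0"
proof
  assume "X \<in> convex hull {A, B, C}"
  then obtain u v w where "u \<ge> 0" "v \<ge> 0" "w \<ge> 0" "u + v + w = 1" "X = u *\<^sub>R A + v *\<^sub>R B + w *\<^sub>R C"
    by (auto simp: convex_hull_3)
  moreover have "cross2 (B - C) (C - A) \<noteq> 0" "cross2 (C - A) (A - B) \<noteq> 0"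
    using assms cross2_cyclic by metis+
  ultimately show "bary A B C X \<ge> 0 \<and> bary B C A X \<ge> 0 \<and> bary C A B X \<ge> 0"
    using bary_comb[of A B C u v w] bary_comb[of B C A v w u] bary_comb[of C A B w u v] assms
    by (simp add: algebra_simps)
next
  assume "bary A B C X \<ge> 0 \<and> bary B C A X \<ge> 0 \<and> bary C A B X \<ge> 0"
  then show "X \<in> convex hull {A, B, C}"
    using bary_expand[OF assms, of X] bary_sum[OF assms, of X] unfolding convex_hull_3 by blast
qed

lemma interior_triangle_bary:
  assumes "\<not> collinear {A, B, C}" "X \<in> interior (convex hull {A, B, C})"
  shows "bary A B C X > 0"
proof -
  have nz: "cross2 (A - B) (B - C) \<noteq> 0"
    using assms cross2_eq_0_imp_collinear by blast
  obtain u v w where "u > 0" "u + v + w = 1" "X = u *\<^sub>R A + v *\<^sub>R B + w *\<^sub>R C"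
    using interior_convex_hull_3_minimal[OF assms(1)] assms(2) by auto
  with bary_comb[OF nz] show ?thesis by simp
qed

lemma closed_segment_bary:
  assumes "cross2 (A - B) (B - C) \<noteq> 0" "X \<in> convex hull {A, B, C}"
  shows "X \<in> closed_segment B C \<longleftrightarrow> bary A B C X = 0"
proof
  assume "X \<in> closed_segment B C"
  then obtain u where "X = 0 *\<^sub>R A + (1 - u) *\<^sub>R B + u *\<^sub>R C"
    by (auto simp: closed_segment_def)
  then show "bary A B C X = 0"
    using bary_comb[OF assms(1), of 0 "1 - u" u] by simp
next
  assume 0: "bary A B C X = 0"
  let ?u = "bary C A B X"
  have "?u \<ge> 0" "?u \<le> 1" "bary B C A X = 1 - ?u"
    using 0 assms(2) bary_sum[OF assms(1), of X] by (auto simp: convex_hull_bary[OF assms(1)])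
  then show "X \<in> closed_segment B C"
    using bary_expand[OF assms(1), of X] 0 unfolding closed_segment_def by auto
qed

lemma affine_hull_bary:
  assumes "cross2 (A - B) (B - C) \<noteq> 0"
  shows "affine hull {B, C} = {X. bary A B C X = 0}"
proof -
  have "B \<noteq> C" using assms by (auto simp: cross2_linear)
  then show ?thesis using assms by (simp add: affine_hull_cross2 bary_def)
qed

section \<open>Inscribed ellipses in barycentric coordinates\<close>

lemma bary_ell: "bary A B C (c + s *\<^sub>R e + t *\<^sub>R f) = bary A B C c + s * blin A B C e + t * blin A B C f"
  by (simp only: bary_add blin_linear)

text \<open>Inside the triangle, touching the side \<open>B C\<close> means that the least value of
  the coordinate of \<open>A\<close> on the ellipse,
  \<open>?p - sqrt (?a\<^sup>2 + ?b\<^sup>2)\<close>, is 0.\<close>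

lemma tangent_to_side_ell:
  assumes nz: "cross2 (A - B) (B - C) \<noteq> 0" and ef: "cross2 e f \<noteq> 0"
    and sub: "ell c e f \<subseteq> convex hull {A, B, C}"
  shows "tangent_to_side (ell c e f) B C \<longleftrightarrow>
    bary A B C c > 0 \<and> (bary A B C c)\<^sup>2 = (blin A B C e)\<^sup>2 + (blin A B C f)\<^sup>2"
    (is "_ \<longleftrightarrow> ?R")
proof -
  let ?p = "bary A B C c" and ?a = "blin A B C e" and ?b = "blin A B C f"
  define R where "R = sqrt (?a\<^sup>2 + ?b\<^sup>2)"
  have BC: "B - C \<noteq> 0" using nz by (auto simp: cross2_linear)
  \<comment> \<open>Otherwise both half-diameters would be parallel to \<open>B - C\<close>, hence
    dependent.\<close>
  have "?a\<^sup>2 + ?b\<^sup>2 \<noteq> 0"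
  proof
    assume "?a\<^sup>2 + ?b\<^sup>2 = 0"
    then have "cross2 e (B - C) = 0" "cross2 f (B - C) = 0"
      using nz by (auto simp: sum_power2_eq_zero_iff blin_def)
    then obtain k l where "e = k *\<^sub>R (B - C)" "f = l *\<^sub>R (B - C)"
      using cross2_eq_0_iff[OF BC] by blast
    with ef show False by (simp add: cross2_linear(5,6,9))
  qed
  moreover have "?a\<^sup>2 + ?b\<^sup>2 \<ge> 0" by simp
  ultimately have pos: "?a\<^sup>2 + ?b\<^sup>2 > 0" by linarith
  then have R: "R > 0" "R\<^sup>2 = ?a\<^sup>2 + ?b\<^sup>2" by (simp_all add: R_def)
  \<comment> \<open>The unit vector opposite to \<open>(?a, ?b)\<close>, where the coordinate is
    least on the ellipse.\<close>
  define s t where "s = - ?a / R" and "t = - ?b / R"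
  have st: "s\<^sup>2 + t\<^sup>2 = 1"
  proof -
    have "s\<^sup>2 + t\<^sup>2 = (?a\<^sup>2 + ?b\<^sup>2) / R\<^sup>2"
      by (simp add: s_def t_def power_divide add_divide_distrib)
    also have "\<dots> = 1" unfolding R(2)[symmetric] using R(1) by simp
    finally show ?thesis .
  qed
  have val: "?p + s * ?a + t * ?b = ?p - R"
  proof -
    have "s * ?a + t * ?b = - ((?a\<^sup>2 + ?b\<^sup>2) / R)"
      by (simp add: s_def t_def power2_eq_square add_divide_distrib)
    also have "\<dots> = - R" unfolding R(2)[symmetric] using R(1) by (simp add: power2_eq_square)
    finally show ?thesis by simp
  qed
  have R_iff: "?R \<longleftrightarrow> ?p = R"
    using R by (metis less_imp_le power2_eq_imp_eq)
  show ?thesis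
    unfolding R_iff
  proof
    assume "tangent_to_side (ell c e f) B C"
    then obtain Q where Q: "Q \<in> ell c e f" "Q \<in> closed_segment B C"
      by (auto simp: tangent_to_side_def)
    then have b0: "bary A B C Q = 0"
      using closed_segment_bary[OF nz, of Q] sub by blast
    obtain x y where xy: "x\<^sup>2 + y\<^sup>2 = 1" and "Q = c + x *\<^sub>R e + y *\<^sub>R f"
      using Q(1) by (auto simp: ell_def)
    with b0 have "?p + x * ?a + y * ?b = 0"
      by (simp only: bary_ell)
    moreover have "(x * ?a + y * ?b)\<^sup>2 \<le> R\<^sup>2"
    proof -
      \<comment> \<open>Cauchy-Schwarz through Lagrange's identity. The contact point thus gives
        \<open>?p \<le> R\<close>, and containment at the minimiser gives the opposite
        inequality.\<close>
      have "R\<^sup>2 * (x\<^sup>2 + y\<^sup>2) - (x * ?a + y * ?b)\<^sup>2 = (x * ?b - y * ?a)\<^sup>2"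
        unfolding R(2) by algebra
      then show ?thesis
        by (metis xy diff_ge_0_iff_ge mult.right_neutral zero_le_power2)
    qed
    then have "\<bar>x * ?a + y * ?b\<bar> \<le> R"
      using R(1) abs_le_square_iff[of "x * ?a + y * ?b" R] by simp
    ultimately have "?p \<le> R" by linarith
    moreover have "?p - R \<ge> 0"
      using sub ellI[OF st, of c e f] convex_hull_bary[OF nz] val by (metis bary_ell subsetD)
    ultimately show "?p = R" by simp
  next
    assume p: "?p = R"
    \<comment> \<open>Rotated so that the minimiser is \<open>c + e'\<close>; the tangent direction
      \<open>f'\<close> there turns out to be parallel to the side.\<close>
    define e' f' where "e' = s *\<^sub>R e + t *\<^sub>R f" and "f' = - t *\<^sub>R e + s *\<^sub>R f"
    have E: "ell c e' f' = ell c e f" and nz': "cross2 e' f' \<noteq> 0"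
      using ell_rotate[OF st] ef by (auto simp: e'_def f'_def)
    have Q: "c + e' \<in> ell c e f"
      using ellI[OF st, of c e f] by (simp add: e'_def add.assoc)
    have b0: "bary A B C (c + e') = 0"
      using val p by (simp add: e'_def bary_add blin_linear)
    have "- t * ?a + s * ?b = 0"
      by (simp add: s_def t_def mult.commute)
    then have "blin A B C f' = 0"
      by (simp only: f'_def blin_linear)
    then have "cross2 f' (B - C) = 0" using nz by (simp add: blin_def)
    moreover have "f' \<noteq> 0" using nz' by (auto simp: cross2_linear)
    ultimately have "{X. cross2 (X - (c + e')) f' = 0} = {X. cross2 (X - (c + e')) (B - C) = 0}"
      using line_eq_iff BC by blast
    also have "\<dots> = {X. bary A B C X = 0}"
    proof -
      have "cross2 (c + e' - B) (B - C) = 0" using b0 nz by (simp add: bary_def)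
      moreover have "X - B = (X - (c + e')) + (c + e' - B)" for X by simp
      ultimately have "cross2 (X - B) (B - C) = cross2 (X - (c + e')) (B - C)" for X
        by (metis add.right_neutral cross2_linear(1))
      then show ?thesis using nz by (simp add: bary_def)
    qed
    finally have "tangent_line (ell c e f) (c + e') = affine hull {B, C}"
      using tangent_line_ell[OF nz', of c] by (simp add: E affine_hull_bary[OF nz])
    moreover have "c + e' \<in> closed_segment B C"
      using closed_segment_bary[OF nz] b0 Q sub by blast
    ultimately show "tangent_to_side (ell c e f) B C"
      unfolding tangent_to_side_def using Q by blast
  qed
qed

lemma inscribed_cyclic: "inscribed_ellipse E B C A \<longleftrightarrow> inscribed_ellipse E A B C"
  by (auto simp: inscribed_ellipse_def insert_commute)

text \<open>The three tangency conditions already force containment: by Cauchy-Schwarz they make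
  every coordinate nonnegative on the ellipse.\<close>

lemma inscribed_ell_iff:
  assumes nz: "cross2 (A - B) (B - C) \<noteq> 0" and ef: "cross2 e f \<noteq> 0"
  shows "inscribed_ellipse (ell c e f) A B C \<longleftrightarrow>
    (bary A B C c > 0 \<and> (bary A B C c)\<^sup>2 = (blin A B C e)\<^sup>2 + (blin A B C f)\<^sup>2) \<and>
    (bary B C A c > 0 \<and> (bary B C A c)\<^sup>2 = (blin B C A e)\<^sup>2 + (blin B C A f)\<^sup>2) \<and>
    (bary C A B c > 0 \<and> (bary C A B c)\<^sup>2 = (blin C A B e)\<^sup>2 + (blin C A B f)\<^sup>2)"
    (is "_ \<longleftrightarrow> ?R")
proof -
  have nz': "cross2 (B - C) (C - A) \<noteq> 0" "cross2 (C - A) (A - B) \<noteq> 0"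
    using nz cross2_cyclic by metis+
  have hull: "convex hull {B, C, A} = convex hull {A, B, C}" "convex hull {C, A, B} = convex hull {A, B, C}"
    by (simp_all add: insert_commute)
  have nonneg: "p + s * a + t * b \<ge> 0" if "p > 0" "p\<^sup>2 = a\<^sup>2 + b\<^sup>2" "s\<^sup>2 + t\<^sup>2 = 1" for p a b s t :: real
  proof -
    have "p\<^sup>2 * (s\<^sup>2 + t\<^sup>2) - (s * a + t * b)\<^sup>2 = (s * b - t * a)\<^sup>2"
      unfolding that(2) by algebra
    then have "(s * a + t * b)\<^sup>2 \<le> p\<^sup>2"
      by (metis that(3) diff_ge_0_iff_ge mult.right_neutral zero_le_power2)
    then have "\<bar>s * a + t * b\<bar> \<le> p"
      using that(1) abs_le_square_iff[of "s * a + t * b" p] by simp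
    then show ?thesis by linarith
  qed
  have sub: "ell c e f \<subseteq> convex hull {A, B, C}" if ?R
    using that nonneg by (auto simp: ell_def convex_hull_bary[OF nz] bary_ell)
  have "is_ellipse (ell c e f)" using ef is_ellipse_iff by blast
  then show ?thesis
    unfolding inscribed_ellipse_def
    using sub tangent_to_side_ell[OF nz ef, of c] tangent_to_side_ell[OF nz'(1) ef, of c]
      tangent_to_side_ell[OF nz'(2) ef, of c] hull by metis
qed

section \<open>Inscribed ellipses through \<open>P\<close> with a prescribed tangent
  direction\<close>

lemma cross2_vertex_iff:
  assumes nz: "cross2 (A - B) (B - C) \<noteq> 0" and pos: "bary A B C P > 0"
  shows "cross2 (P - C) d = 0 \<longleftrightarrow> blin A B C d * bary B C A P = blin B C A d * bary A B C P"
proof -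
  have nz': "cross2 (B - C) (C - A) \<noteq> 0" using nz cross2_cyclic by metis
  have "bary A B C C = 0" "bary B C A C = 0"
    by (simp_all add: bary_def cross2_commute[of C B] cross2_linear)
  \<comment> \<open>The coordinates of \<open>A\<close> and \<open>B\<close> vanish at
    \<open>C\<close>, so \<open>P - C\<close> inherits them from \<open>P\<close>. Being parallel to
    \<open>P - C\<close> thus becomes proportionality of these two coordinates.\<close>
  then have PC: "blin A B C (P - C) = bary A B C P" "blin B C A (P - C) = bary B C A P"
    using bary_add[of A B C C "P - C"] bary_add[of B C A C "P - C"] by simp_all
  show ?thesis
  proof
    assume 0: "cross2 (P - C) d = 0"
    have "P - C \<noteq> 0" using PC pos by (auto simp: blin_def cross2_linear)
    moreover have "cross2 d (P - C) = 0" using 0 cross2_commute[of d "P - C"] by simp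
    ultimately obtain k where "d = k *\<^sub>R (P - C)"
      using cross2_eq_0_iff by blast
    then show "blin A B C d * bary B C A P = blin B C A d * bary A B C P"
      by (simp only: blin_linear(2) PC mult_ac)
  next
    assume "blin A B C d * bary B C A P = blin B C A d * bary A B C P"
    then have "bary A B C P *\<^sub>R d = blin A B C d *\<^sub>R (P - C)"
      by (intro blin_eqI[OF nz]) (simp_all only: blin_linear(2) PC mult.commute)
    then have "bary A B C P * cross2 (P - C) d = blin A B C d * cross2 (P - C) (P - C)"
      by (metis cross2_linear(6))
    then show "cross2 (P - C) d = 0"
      using pos by (simp only: cross2_linear(9)) simp
  qed
qed

lemma inscribed_through_point:
  assumes nz: "cross2 (A - B) (B - C) \<noteq> 0" and d: "d \<noteq> 0"
    and pos: "bary A B C P > 0" "bary B C A P > 0" "bary C A B P > 0"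
    and E: "inscribed_ellipse E A B C" "P \<in> E" "tangent_line E P = {X. cross2 (X - P) d = 0}"
  obtains e k where "cross2 e (k *\<^sub>R d) \<noteq> 0" "E = ell (P - e) e (k *\<^sub>R d)"
    "blin A B C e = (bary A B C P - k\<^sup>2 * (blin A B C d)\<^sup>2 / bary A B C P) / 2"
    "blin B C A e = (bary B C A P - k\<^sup>2 * (blin B C A d)\<^sup>2 / bary B C A P) / 2"
    "k\<^sup>2 * ((blin A B C d)\<^sup>2 / bary A B C P + (blin B C A d)\<^sup>2 / bary B C A P
      + (blin C A B d)\<^sup>2 / bary C A B P) = 1"
proof -
  obtain c e f where ef: "cross2 e f \<noteq> 0" "E = ell c e f" "P = c + e"
    using E ell_through_point unfolding inscribed_ellipse_def is_ellipse_iff by metis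
  have "f \<noteq> 0" using ef by (auto simp: cross2_linear)
  moreover have "{X. cross2 (X - P) f = 0} = {X. cross2 (X - P) d = 0}"
    using tangent_line_ell[OF ef(1), of c] E(3) ef by simp
  ultimately have "cross2 f d = 0" using line_eq_iff d by blast
  then obtain k where k: "f = k *\<^sub>R d" using cross2_eq_0_iff[OF d] by blast
  have c: "c = P - e" using ef by simp
  \<comment> \<open>The square of \<open>a\<close> cancels, which leaves a linear equation for
    \<open>a\<close>.\<close>
  have half: "a = (x - k\<^sup>2 * \<delta>\<^sup>2 / x) / 2"
    if "x > 0" "(x - a)\<^sup>2 = a\<^sup>2 + (k * \<delta>)\<^sup>2" for x a \<delta> :: real
  proof -
    have "x * x - 2 * a * x = k\<^sup>2 * \<delta>\<^sup>2"
      using that(2) by (simp add: power2_eq_square algebra_simps)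
    then show ?thesis using that(1) by (simp add: field_simps)
  qed
  have insc: "(bary A B C P - blin A B C e)\<^sup>2 = (blin A B C e)\<^sup>2 + (k * blin A B C d)\<^sup>2"
    "(bary B C A P - blin B C A e)\<^sup>2 = (blin B C A e)\<^sup>2 + (k * blin B C A d)\<^sup>2"
    "(bary C A B P - blin C A B e)\<^sup>2 = (blin C A B e)\<^sup>2 + (k * blin C A B d)\<^sup>2"
    using E(1)[unfolded ef(2), unfolded inscribed_ell_iff[OF nz ef(1)], unfolded c k bary_diff blin_linear]
    by blast+
  note h = half[OF pos(1) insc(1)] half[OF pos(2) insc(2)] half[OF pos(3) insc(3)]
  \<comment> \<open>Adding the three formulas for the coordinates of \<open>e\<close>: the left
    sides sum to 0 and the coordinates of \<open>P\<close> to 1.\<close>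
  have "k\<^sup>2 * ((blin A B C d)\<^sup>2 / bary A B C P + (blin B C A d)\<^sup>2 / bary B C A P
      + (blin C A B d)\<^sup>2 / bary C A B P) = 1"
    using blin_sum[OF nz, of e] bary_sum[OF nz, of P] h
    unfolding distrib_left times_divide_eq_right by argo
  with that[of e k] ef(1,2) h c k show ?thesis by blast
qed

text \<open>The normalisation fixes \<open>k\<^sup>2\<close>, which determines \<open>e\<close>; the
  remaining sign of \<open>k\<close> only reflects the parametrisation.\<close>

lemma inscribed_through_point_unique:
  assumes nz: "cross2 (A - B) (B - C) \<noteq> 0" and d: "d \<noteq> 0"
    and pos: "bary A B C P > 0" "bary B C A P > 0" "bary C A B P > 0"
    and E: "inscribed_ellipse E A B C" "P \<in> E" "tangent_line E P = {X. cross2 (X - P) d = 0}"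
    and E': "inscribed_ellipse E' A B C" "P \<in> E'" "tangent_line E' P = {X. cross2 (X - P) d = 0}"
  shows "E = E'"
proof -
  obtain e k where e: "E = ell (P - e) e (k *\<^sub>R d)"
    "blin A B C e = (bary A B C P - k\<^sup>2 * (blin A B C d)\<^sup>2 / bary A B C P) / 2"
    "blin B C A e = (bary B C A P - k\<^sup>2 * (blin B C A d)\<^sup>2 / bary B C A P) / 2"
    "k\<^sup>2 * ((blin A B C d)\<^sup>2 / bary A B C P + (blin B C A d)\<^sup>2 / bary B C A P
      + (blin C A B d)\<^sup>2 / bary C A B P) = 1"
    using inscribed_through_point[OF nz d pos E] by metis
  obtain e' k' where e': "E' = ell (P - e') e' (k' *\<^sub>R d)"
    "blin A B C e' = (bary A B C P - k'\<^sup>2 * (blin A B C d)\<^sup>2 / bary A B C P) / 2"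
    "blin B C A e' = (bary B C A P - k'\<^sup>2 * (blin B C A d)\<^sup>2 / bary B C A P) / 2"
    "k'\<^sup>2 * ((blin A B C d)\<^sup>2 / bary A B C P + (blin B C A d)\<^sup>2 / bary B C A P
      + (blin C A B d)\<^sup>2 / bary C A B P) = 1"
    using inscribed_through_point[OF nz d pos E'] by metis
  \<comment> \<open>Both squares have product 1 with the same sum, which is therefore nonzero and
    can be cancelled.\<close>
  have k2: "k\<^sup>2 = k'\<^sup>2" using e(4) e'(4)
    by (metis mult_cancel_right mult_zero_right zero_neq_one)
  have ee: "e = e'"
    by (rule blin_eqI[OF nz]) (simp_all only: e e' k2)
  have "k = k' \<or> k = - k'" using k2 by (simp add: power2_eq_iff)
  then have "ell (P - e') e' (k *\<^sub>R d) = ell (P - e') e' (k' *\<^sub>R d)"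
    by (metis ell_reflect scaleR_minus_left)
  then show ?thesis unfolding e(1) e'(1) ee .
qed

text \<open>If \<open>d\<close> is parallel to \<open>P - C\<close>, the formulas for
  \<open>e\<close> make it parallel to \<open>P - C\<close> too, so the half-diameters are
  dependent. The other vertices follow by cyclic symmetry.\<close>

lemma no_inscribed_towards_vertex:
  assumes nz: "cross2 (A - B) (B - C) \<noteq> 0" and d: "d \<noteq> 0"
    and pos: "bary A B C P > 0" "bary B C A P > 0" "bary C A B P > 0"
    and E: "inscribed_ellipse E A B C" "P \<in> E" "tangent_line E P = {X. cross2 (X - P) d = 0}"
  shows "cross2 (P - C) d \<noteq> 0"
proof
  assume V: "cross2 (P - C) d = 0"
  obtain e k where e: "cross2 e (k *\<^sub>R d) \<noteq> 0"
    "blin A B C e = (bary A B C P - k\<^sup>2 * (blin A B C d)\<^sup>2 / bary A B C P) / 2"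
    "blin B C A e = (bary B C A P - k\<^sup>2 * (blin B C A d)\<^sup>2 / bary B C A P) / 2"
    using inscribed_through_point[OF nz d pos E] by metis
  have scaled: "(x - k\<^sup>2 * \<delta>\<^sup>2 / x) / 2 * y = (y - k\<^sup>2 * \<epsilon>\<^sup>2 / y) / 2 * x"
    if "x > 0" "y > 0" "\<delta> * y = \<epsilon> * x" for x y \<delta> \<epsilon> :: real
  proof -
    have \<delta>: "\<delta> = \<epsilon> * x / y" using that by (simp add: field_simps)
    show ?thesis unfolding \<delta> using that(1,2) by (simp add: field_simps power2_eq_square)
  qed
  have "cross2 (P - C) e = 0"
    unfolding cross2_vertex_iff[OF nz pos(1)] e
    using scaled pos V cross2_vertex_iff[OF nz pos(1)] by blast
  then have "cross2 e (P - C) = 0" "cross2 d (P - C) = 0"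
    using V cross2_commute[of e "P - C"] cross2_commute[of d "P - C"] by simp_all
  moreover have "P - C \<noteq> 0"
    using pos(1) by (auto simp: bary_def cross2_linear cross2_commute[of C B])
  ultimately obtain u v where "e = u *\<^sub>R (P - C)" "d = v *\<^sub>R (P - C)"
    using cross2_eq_0_iff by blast
  with e(1) show False by (simp add: cross2_linear(5,6,9))
qed

text \<open>Takes the necessary formulas for \<open>k\<close> and \<open>e\<close> as definitions;
  the conditions on the vertices enter in proving the half-diameters independent.\<close>

lemma inscribed_through_point_exists:
  assumes nz: "cross2 (A - B) (B - C) \<noteq> 0"
    and pos: "bary A B C P > 0" "bary B C A P > 0" "bary C A B P > 0"
    and V: "cross2 (P - A) d \<noteq> 0" "cross2 (P - B) d \<noteq> 0" "cross2 (P - C) d \<noteq> 0"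
  shows "\<exists>E. inscribed_ellipse E A B C \<and> P \<in> E \<and> tangent_line E P = {X. cross2 (X - P) d = 0}"
proof -
  have nz': "cross2 (B - C) (C - A) \<noteq> 0" "cross2 (C - A) (A - B) \<noteq> 0"
    using nz cross2_cyclic by metis+
  define x1 x2 x3 where x: "x1 = bary A B C P" "x2 = bary B C A P" "x3 = bary C A B P"
  define d1 d2 d3 where d: "d1 = blin A B C d" "d2 = blin B C A d" "d3 = blin C A B d"
  have x0: "x1 > 0" "x2 > 0" "x3 > 0" using pos by (simp_all add: x)
  have xs: "x1 + x2 + x3 = 1" and ds: "d1 + d2 + d3 = 0"
    unfolding x d by (rule bary_sum[OF nz] blin_sum[OF nz])+
  have ratios: "d1 * x2 \<noteq> d2 * x1" "d2 * x3 \<noteq> d3 * x2" "d3 * x1 \<noteq> d1 * x3"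
    using V cross2_vertex_iff[OF nz pos(1)] cross2_vertex_iff[OF nz'(1) pos(2)]
      cross2_vertex_iff[OF nz'(2) pos(3)] by (simp_all add: x d)
  define S where "S = d1\<^sup>2 / x1 + d2\<^sup>2 / x2 + d3\<^sup>2 / x3"
  have nonneg: "d1\<^sup>2 / x1 \<ge> 0" "d2\<^sup>2 / x2 \<ge> 0" "d3\<^sup>2 / x3 \<ge> 0"
    using x0 by simp_all
  have "d1 \<noteq> 0 \<or> d2 \<noteq> 0" using ratios(1) by auto
  then have "d1\<^sup>2 / x1 > 0 \<or> d2\<^sup>2 / x2 > 0" using x0 by (auto intro: divide_pos_pos)
  with nonneg have S: "S > 0" unfolding S_def by linarith
  define k where "k = 1 / sqrt S"
  have k: "k \<noteq> 0" "k\<^sup>2 * S = 1" using S by (simp_all add: k_def power_divide)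
  define a where "a x \<delta> = (x - k\<^sup>2 * \<delta>\<^sup>2 / x) / 2" for x \<delta> :: real
  \<comment> \<open>The coefficients sum to 0, so they are the barycentric components of a
    vector.\<close>
  define e where "e = a x1 d1 *\<^sub>R A + a x2 d2 *\<^sub>R B + a x3 d3 *\<^sub>R C"
  have "a x1 d1 + a x2 d2 + a x3 d3 = (x1 + x2 + x3 - k\<^sup>2 * S) / 2"
    unfolding a_def S_def by (simp add: field_simps)
  then have as: "a x1 d1 + a x2 d2 + a x3 d3 = 0" using xs k by simp
  have e: "blin A B C e = a x1 d1" "blin B C A e = a x2 d2" "blin C A B e = a x3 d3"
    using blin_comb[OF nz as] blin_comb[OF nz'(1), of "a x2 d2" "a x3 d3" "a x1 d1"]
      blin_comb[OF nz'(2), of "a x3 d3" "a x1 d1" "a x2 d2"] as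
    by (simp_all add: e_def add_ac)
  have d0: "d \<noteq> 0" using V by (auto simp: cross2_linear)
  then have kd0: "k *\<^sub>R d \<noteq> 0" using k by simp
  have ef: "cross2 e (k *\<^sub>R d) \<noteq> 0"
  proof
    assume "cross2 e (k *\<^sub>R d) = 0"
    then obtain l where "e = l *\<^sub>R k *\<^sub>R d" using cross2_eq_0_iff[OF kd0] by blast
    then have "blin A B C e = l * (k * d1)" "blin B C A e = l * (k * d2)" "blin C A B e = l * (k * d3)"
      by (simp_all only: blin_linear d)
    note l = this[unfolded e]
    \<comment> \<open>If \<open>e\<close> and \<open>d\<close> were dependent, the three distinct ratios would be roots of one quadratic.\<close>
    define r where "r x \<delta> = k * \<delta> / x" for x \<delta> :: real
    have root: "1 - (r x \<delta>)\<^sup>2 = 2 * l * r x \<delta>" if "x > 0" "a x \<delta> = l * (k * \<delta>)" for x \<delta>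
    proof -
      have r: "k\<^sup>2 * \<delta>\<^sup>2 / x = (r x \<delta>)\<^sup>2 * x" "k * \<delta> = r x \<delta> * x"
        using that(1) by (simp_all add: r_def power2_eq_square)
      have "(x - (r x \<delta>)\<^sup>2 * x) / 2 = l * (r x \<delta> * x)"
        using that(2) unfolding a_def r .
      then have "x * (1 - (r x \<delta>)\<^sup>2) = x * (2 * l * r x \<delta>)"
        by (simp add: algebra_simps)
      then show ?thesis using that(1) by simp
    qed
    have sum: "u + v = - 2 * l"
      if "1 - u\<^sup>2 = 2 * l * u" "1 - v\<^sup>2 = 2 * l * v" "u \<noteq> v" for u v
    proof -
      \<comment> \<open>Vieta: two distinct roots of \<open>z\<^sup>2 + 2 * l * z - 1\<close> sum to
        \<open>- 2 * l\<close>.\<close>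
      have "(u - v) * (u + v + 2 * l) = (u\<^sup>2 + 2 * l * u) - (v\<^sup>2 + 2 * l * v)"
        by (simp add: power2_eq_square algebra_simps)
      also have "\<dots> = 0" using that(1,2) by linarith
      finally have "(u - v) * (u + v + 2 * l) = 0" .
      with that(3) show ?thesis by simp
    qed
    have "r x \<delta> \<noteq> r y \<epsilon>" if "x > 0" "y > 0" "\<delta> * y \<noteq> \<epsilon> * x" for x y \<delta> \<epsilon>
      using that k(1) by (simp add: r_def frac_eq_eq mult.assoc)
    then have "r x1 d1 \<noteq> r x2 d2" "r x2 d2 \<noteq> r x3 d3" "r x3 d3 \<noteq> r x1 d1"
      using ratios x0 by blast+
    \<comment> \<open>The first and second ratios have the same sum as the second and third, so the
      first equals the third, a contradiction.\<close>
    then show False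
      using sum[OF root[OF x0(1) l(1)] root[OF x0(2) l(2)]]
        sum[OF root[OF x0(2) l(2)] root[OF x0(3) l(3)]] by simp
  qed
  \<comment> \<open>\<open>x - a x \<delta>\<close> is a coordinate of the centre
    \<open>P - e\<close>; this is the tangency condition for the corresponding side.\<close>
  have p: "x - a x \<delta> > 0 \<and> (x - a x \<delta>)\<^sup>2 = (a x \<delta>)\<^sup>2 + (k * \<delta>)\<^sup>2" if "x > 0" for x \<delta>
  proof
    have "x - (x - q) / 2 = (x + q) / 2" for q :: real by (simp add: field_simps)
    then have "x - a x \<delta> = (x + k\<^sup>2 * \<delta>\<^sup>2 / x) / 2" unfolding a_def .
    also have "\<dots> > 0" using that by (auto intro!: add_pos_nonneg)
    finally show "x - a x \<delta> > 0" .
    show "(x - a x \<delta>)\<^sup>2 = (a x \<delta>)\<^sup>2 + (k * \<delta>)\<^sup>2"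
    proof -
      have "(x - a x \<delta>)\<^sup>2 = (a x \<delta>)\<^sup>2 + x * (x - 2 * a x \<delta>)"
        by (simp add: power2_eq_square algebra_simps)
      also have "x - 2 * a x \<delta> = k\<^sup>2 * \<delta>\<^sup>2 / x"
      proof -
        have "x - 2 * ((x - q) / 2) = q" for q :: real by (simp add: field_simps)
        then show ?thesis unfolding a_def .
      qed
      also have "x * \<dots> = (k * \<delta>)\<^sup>2" using that by (simp add: power_mult_distrib)
      finally show ?thesis .
    qed
  qed
  have "inscribed_ellipse (ell (P - e) e (k *\<^sub>R d)) A B C"
    unfolding inscribed_ell_iff[OF nz ef] bary_diff blin_linear e x[symmetric] d[symmetric]
    using p[OF x0(1), of d1] p[OF x0(2), of d2] p[OF x0(3), of d3] by blast
  moreover have "P \<in> ell (P - e) e (k *\<^sub>R d)"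
    using ellI[of 1 0 "P - e" e "k *\<^sub>R d"] by simp
  moreover have "tangent_line (ell (P - e) e (k *\<^sub>R d)) P = {X. cross2 (X - P) d = 0}"
    using tangent_line_ell[OF ef, of "P - e"] k(1) by (simp add: cross2_linear(6))
  ultimately show ?thesis by blast
qed

text \<open>The whole dichotomy for an arbitrary direction \<open>d\<close>, to be applied to
  \<open>(1, r)\<close> and \<open>(0, 1)\<close>.\<close>

lemma inscribed_in_direction:
  assumes tri: "\<not> collinear {A, B, C}" and int: "P \<in> interior (convex hull {A, B, C})" and d: "d \<noteq> 0"
  defines "good \<equiv> \<lambda>E. inscribed_ellipse E A B C \<and> P \<in> E \<and> tangent_line E P = {X. cross2 (X - P) d = 0}"
  shows "\<forall>V \<in> {A, B, C}. affine hull {P, V} \<noteq> {X. cross2 (X - P) d = 0} \<Longrightarrow> \<exists>!E. good E"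
    and "\<exists>V \<in> {A, B, C}. affine hull {P, V} = {X. cross2 (X - P) d = 0} \<Longrightarrow> \<nexists>E. good E"
proof -
  have nz: "cross2 (A - B) (B - C) \<noteq> 0" "cross2 (B - C) (C - A) \<noteq> 0" "cross2 (C - A) (A - B) \<noteq> 0"
    using cross2_eq_0_imp_collinear tri cross2_cyclic by metis+
  have pos: "bary A B C P > 0" "bary B C A P > 0" "bary C A B P > 0"
    using interior_triangle_bary[of A B C P] interior_triangle_bary[of B C A P]
      interior_triangle_bary[of C A B P] tri int by (simp_all add: insert_commute)
  \<comment> \<open>At each vertex some barycentric coordinate vanishes, whereas all are positive at
    \<open>P\<close>.\<close>
  have "P \<noteq> V" if "V \<in> {A, B, C}" for V
    using that pos by (auto simp: bary_def cross2_linear)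
  then have vertex: "affine hull {P, V} = {X. cross2 (X - P) d = 0} \<longleftrightarrow> cross2 (P - V) d = 0"
    if "V \<in> {A, B, C}" for V
    using that d by (simp add: affine_hull_cross2 line_eq_iff)
  show "\<exists>!E. good E" if "\<forall>V \<in> {A, B, C}. affine hull {P, V} \<noteq> {X. cross2 (X - P) d = 0}"
  proof (rule ex_ex1I)
    have "cross2 (P - A) d \<noteq> 0" "cross2 (P - B) d \<noteq> 0" "cross2 (P - C) d \<noteq> 0"
      using that vertex by auto
    then show "\<exists>E. good E"
      unfolding good_def by (rule inscribed_through_point_exists[OF nz(1) pos])
    show "E = E'" if "good E" "good E'" for E E'
      using that unfolding good_def
      by (elim conjE) (rule inscribed_through_point_unique[OF nz(1) d pos])
  qed
  show "\<nexists>E. good E" if bad: "\<exists>V \<in> {A, B, C}. affine hull {P, V} = {X. cross2 (X - P) d = 0}"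
  proof
    assume "\<exists>E. good E"
    then obtain E where E: "inscribed_ellipse E A B C" "P \<in> E" "tangent_line E P = {X. cross2 (X - P) d = 0}"
      unfolding good_def by blast
    have E': "inscribed_ellipse E B C A" by (rule inscribed_cyclic[THEN iffD2, OF E(1)])
    have "cross2 (P - A) d \<noteq> 0" "cross2 (P - B) d \<noteq> 0" "cross2 (P - C) d \<noteq> 0"
      using no_inscribed_towards_vertex[OF nz(2) d pos(2,3,1) E' E(2,3)]
        no_inscribed_towards_vertex[OF nz(3) d pos(3,1,2) inscribed_cyclic[THEN iffD2, OF E'] E(2,3)]
        no_inscribed_towards_vertex[OF nz(1) d pos E] by blast+
    with bad vertex show False by auto
  qed
qed

text \<open>The vertical direction is treated like a slope: the second conjunct assumes that no
  vertex lies on the vertical line through \<open>P\<close>, and the fourth shows that in the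
  excluded case no such ellipse exists.\<close>

theorem theorem2p1:
  fixes A B C P :: "real \<times> real"
  assumes "\<not> collinear {A, B, C}"
    and "P \<in> interior (convex hull {A, B, C})"
  shows
    "(\<forall>r. (\<forall>V \<in> {A, B, C}. \<not> has_slope (affine hull {P, V}) r) \<longrightarrow>
        (\<exists>!E. inscribed_ellipse E A B C \<and> P \<in> E \<and> has_slope (tangent_line E P) r)) \<and>
     ((\<forall>V \<in> {A, B, C}. \<not> is_vertical (affine hull {P, V})) \<longrightarrow>
        (\<exists>!E. inscribed_ellipse E A B C \<and> P \<in> E \<and> is_vertical (tangent_line E P))) \<and>
     (\<forall>r. (\<exists>V \<in> {A, B, C}. has_slope (affine hull {P, V}) r) \<longrightarrow>
        \<not> (\<exists>E. inscribed_ellipse E A B C \<and> P \<in> E \<and> has_slope (tangent_line E P) r)) \<and>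
     ((\<exists>V \<in> {A, B, C}. is_vertical (affine hull {P, V})) \<longrightarrow>
        \<not> (\<exists>E. inscribed_ellipse E A B C \<and> P \<in> E \<and> is_vertical (tangent_line E P)))"
proof -
  have P: "P \<in> affine hull {P, V}" for V
    by (simp add: hull_inc)
  have d: "(1, r) \<noteq> (0 :: real \<times> real)" "(0, 1) \<noteq> (0 :: real \<times> real)" for r
    by (simp_all add: zero_prod_def)
  have slope: "inscribed_ellipse E A B C \<and> P \<in> E \<and> has_slope (tangent_line E P) r \<longleftrightarrow>
      inscribed_ellipse E A B C \<and> P \<in> E \<and> tangent_line E P = {X. cross2 (X - P) (1, r) = 0}" for E r
    using has_slope_iff point_in_tangent_line by metis
  have vert: "inscribed_ellipse E A B C \<and> P \<in> E \<and> is_vertical (tangent_line E P) \<longleftrightarrow>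
      inscribed_ellipse E A B C \<and> P \<in> E \<and> tangent_line E P = {X. cross2 (X - P) (0, 1) = 0}" for E
    using is_vertical_iff point_in_tangent_line by metis
  show ?thesis
    unfolding slope vert has_slope_iff[OF P] is_vertical_iff[OF P]
    by (intro conjI allI impI;
        erule inscribed_in_direction[OF assms d(1)] inscribed_in_direction[OF assms d(2)])
qed

end
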